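(* Let $m,n$ be odd positive integers and let $\lambda\in\mathbb{C}$. On $\mathbb{C}\setminus\{0\}$ put $$f(\omega)=2\,\omega^{-m-n-2}\bigl(\omega^{2m+2n}-1\bigr),\qquad g(\omega)=\omega^{m},\qquad h(\omega)=\lambda\,\omega^{n}.$$ Then the integral $$\int\Bigl(\tfrac12 f(1-g^2-h^2),\ \tfrac{\mathrm i}{2}f(1+g^2+h^2),\ fg,\ fh\Bigr)\,d\omega$$ is the curve $X=(X_1,X_2,X_3,X_4):\mathbb{C}\setminus\{0\}\to\mathbb{C}^4$ given by $$X_1(\omega)=\frac{\omega^{m+n-1}}{m+n-1}-\frac{\omega^{3m+n-1}}{3m+n-1}-\lambda^2\frac{\omega^{m+3n-1}}{m+3n-1}+\frac{\omega^{-(m+n+1)}}{m+n+1}+\frac{\omega^{m-n-1}}{m-n-1}+\lambda^2\frac{\omega^{n-m-1}}{n-m-1}+C_1,$$ $$X_2(\omega)=\mathrm i\left(\frac{\omega^{m+n-1}}{m+n-1}+\frac{\omega^{3m+n-1}}{3m+n-1}+\lambda^2\frac{\omega^{m+3n-1}}{m+3n-1}+\frac{\omega^{-(m+n+1)}}{m+n+1}-\frac{\omega^{m-n-1}}{m-n-1}-\lambda^2\frac{\omega^{n-m-1}}{n-m-1}\right)+C_2,$$ $$X_3(\omega)=2\left(\frac{\omega^{2m+n-1}}{2m+n-1}+\frac{\omega^{-(n+1)}}{n+1}\right)+C_3,$$ $$X_4(\omega)=2\lambda\left(\frac{\omega^{m+2n-1}}{m+2n-1}+\frac{\omega^{-(m+1)}}{m+1}\right)+C_4,$$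 with arbitrary constants $C_1,\dots,C_4\in\mathbb{C}$. That is, $X'=\bigl(\tfrac12 f(1-g^2-h^2),\ \tfrac{\mathrm i}{2}f(1+g^2+h^2),\ fg,\ fh\bigr)$ on $\mathbb{C}\setminus\{0\}$, and the real part $\operatorname{Re}X$ is the Henneberg-type minimal surface $\mathcal{H}_{(m,n)}$ in $\mathbb{R}^4$.
   Context: For holomorphic functions $f,g,h$ on a domain $D\subset\mathbb{C}$, the associated surface in $\mathbb{R}^4$ is the real part of $\int\bigl(\tfrac12 f(1-g^2-h^2),\ \tfrac{\mathrm i}{2}f(1+g^2+h^2),\ fg,\ fh\bigr)\,d\omega$, determined up to an additive constant; it is a conformal minimal immersion at the points where $|f|(1+|g|^2+|h|^2)\neq0$ (regular points). The higher-order Henneberg-type minimal surface $\mathcal{H}_{(m,n)}$ ($m,n$ odd positive integers, $\lambda\in\mathbb{C}$ a parameter) is the surface associated in this way to $f(\omega)=2\omega^{-m-n-2}(\omega^{2m+2n}-1)$, $g(\omega)=\omega^m$, $h(\omega)=\lambda\omega^n$ on $\mathbb{C}\setminus\{0\}$. *)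

theory Defs
  imports "HOL-Analysis.Analysis"
begin

lemma vector_4_nth [simp]:
  "(vector [a, b, c, d] :: 'a::zero ^ 4) $ 1 = a"
  "(vector [a, b, c, d] :: 'a::zero ^ 4) $ 2 = b"
  "(vector [a, b, c, d] :: 'a::zero ^ 4) $ 3 = c"
  "(vector [a, b, c, d] :: 'a::zero ^ 4) $ 4 = d"
  unfolding vector_def by simp_all

definition weierstrass_integrand ::
    "(complex \<Rightarrow> complex) \<Rightarrow> (complex \<Rightarrow> complex) \<Rightarrow> (complex \<Rightarrow> complex) \<Rightarrow> complex \<Rightarrow> complex ^ 4"
  where "weierstrass_integrand f g h w =
    vector [1 / 2 * f w * (1 - (g w)\<^sup>2 - (h w)\<^sup>2),
            \<i> / 2 * f w * (1 + (g w)\<^sup>2 + (h w)\<^sup>2),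
            f w * g w,
            f w * h w]"

text \<open>
  The indefinite integral of a curve \<open>\<Phi>\<close> on an open set \<open>D\<close> is the set of all its
  primitives.  The derivative is complex and taken componentwise, since \<^typ>\<open>complex ^ 4\<close>
  is only a real normed space in the library; values outside \<open>D\<close> are irrelevant.
\<close>

definition indefinite_integral :: "complex set \<Rightarrow> (complex \<Rightarrow> complex ^ 4) \<Rightarrow> (complex \<Rightarrow> complex ^ 4) set"
  where "indefinite_integral D \<Phi> =
    {X. \<forall>w\<in>D. \<forall>i. ((\<lambda>z. X z $ i) has_field_derivative \<Phi> w $ i) (at w)}"

definition Re_vec :: "complex ^ 4 \<Rightarrow> real ^ 4"
  where "Re_vec v = (\<chi> i. Re (v $ i))"

text \<open>
  A surface determined up to an additive constant is represented by the set of all its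
  parametrizations on \<open>D\<close>.
\<close>

definition associated_surface ::
    "complex set \<Rightarrow> (complex \<Rightarrow> complex) \<Rightarrow> (complex \<Rightarrow> complex) \<Rightarrow> (complex \<Rightarrow> complex) \<Rightarrow> (complex \<Rightarrow> real ^ 4) set"
  where "associated_surface D f g h =
    {Y. \<exists>X \<in> indefinite_integral D (weierstrass_integrand f g h). \<forall>w\<in>D. Y w = Re_vec (X w)}"

text \<open>The exponents are integers, so that no subtraction is truncated.\<close>

definition henneberg_f :: "int \<Rightarrow> int \<Rightarrow> complex \<Rightarrow> complex"
  where "henneberg_f m n w = 2 * w powi (- m - n - 2) * (w powi (2 * m + 2 * n) - 1)"

definition henneberg_g :: "int \<Rightarrow> complex \<Rightarrow> complex"
  where "henneberg_g m w = w powi m"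

definition henneberg_h :: "int \<Rightarrow> complex \<Rightarrow> complex \<Rightarrow> complex"
  where "henneberg_h n lam w = lam * w powi n"

definition henneberg_surface :: "int \<Rightarrow> int \<Rightarrow> complex \<Rightarrow> (complex \<Rightarrow> real ^ 4) set"
  where "henneberg_surface m n lam =
    associated_surface (- {0}) (henneberg_f m n) (henneberg_g m) (henneberg_h n lam)"

definition henneberg_curve :: "int \<Rightarrow> int \<Rightarrow> complex \<Rightarrow> complex ^ 4 \<Rightarrow> complex \<Rightarrow> complex ^ 4"
  where "henneberg_curve m n lam C w = vector
    [w powi (m + n - 1) / of_int (m + n - 1)
       - w powi (3 * m + n - 1) / of_int (3 * m + n - 1)
       - lam\<^sup>2 * (w powi (m + 3 * n - 1) / of_int (m + 3 * n - 1))
       + w powi (- (m + n + 1)) / of_int (m + n + 1)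
       + w powi (m - n - 1) / of_int (m - n - 1)
       + lam\<^sup>2 * (w powi (n - m - 1) / of_int (n - m - 1))
       + C $ 1,
     \<i> * (w powi (m + n - 1) / of_int (m + n - 1)
       + w powi (3 * m + n - 1) / of_int (3 * m + n - 1)
       + lam\<^sup>2 * (w powi (m + 3 * n - 1) / of_int (m + 3 * n - 1))
       + w powi (- (m + n + 1)) / of_int (m + n + 1)
       - w powi (m - n - 1) / of_int (m - n - 1)
       - lam\<^sup>2 * (w powi (n - m - 1) / of_int (n - m - 1)))
       + C $ 2,
     2 * (w powi (2 * m + n - 1) / of_int (2 * m + n - 1)
       + w powi (- (n + 1)) / of_int (n + 1))
       + C $ 3,
     2 * lam * (w powi (m + 2 * n - 1) / of_int (m + 2 * n - 1)
       + w powi (- (m + 1)) / of_int (m + 1))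
       + C $ 4]"

end

theory Submission
  imports Defs
begin

text \<open>
  Since \<open>f w = 2 * (w powi (m + n - 2) - w powi (- m - n - 2))\<close>, each component of the integrand is
  a linear combination of integer powers of \<open>w\<close>.  On the punctured plane the power with
  exponent \<open>k - 1\<close> has the single-valued primitive \<open>w powi k / k\<close> except when \<open>k = 0\<close>, so the
  only possible obstruction is a term \<open>1 / w\<close>.  Positivity of \<open>m\<close> and \<open>n\<close> excludes it
  wherever \<open>m\<close> and \<open>n\<close> enter with the same sign; for the two remaining terms, with
  \<open>k = m - n - 1\<close> and \<open>k = n - m - 1\<close>, parity does: a difference of odd numbers is even,
  so \<open>k\<close> is odd.  Hence integrating term by term gives a primitive
  (\<open>henneberg_curve_primitive\<close>).

  Conversely the punctured plane is connected, so two primitives differ by a constant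
  vector (\<open>indefinite_integral_eq_translates\<close>).  The description of the surface follows by
  taking real parts.
\<close>

text \<open>
  Connectedness makes the difference of two primitives constant in each component.  Openness
  also gives the converse: a curve agreeing with \<open>F + C\<close> only on \<open>D\<close> still agrees with it
  near each point of \<open>D\<close>, so its values elsewhere do not affect the derivatives.
\<close>

lemma indefinite_integral_eq_translates:
  assumes "open D" and "connected D" and F: "F \<in> indefinite_integral D \<Phi>"
  shows "indefinite_integral D \<Phi> = {X. \<exists>C. \<forall>w\<in>D. X w = F w + C}"
proof (intro set_eqI iffI)
  fix X assume X: "X \<in> indefinite_integral D \<Phi>"
  have "\<exists>c. \<forall>w\<in>D. X w $ i - F w $ i = c" for i
  proof -
    have D: "((\<lambda>w. X w $ i - F w $ i) has_field_derivative 0) (at w)" if "w \<in> D" for w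
    proof -
      have "((\<lambda>z. X z $ i) has_field_derivative \<Phi> w $ i) (at w)"
        and "((\<lambda>z. F z $ i) has_field_derivative \<Phi> w $ i) (at w)"
        using X F that by (simp_all add: indefinite_integral_def)
      from DERIV_diff[OF this] show ?thesis by simp
    qed
    have "(\<lambda>w. X w $ i - F w $ i) constant_on D"
      using D \<open>connected D\<close> \<open>open D\<close> by (rule has_field_derivative_0_imp_constant_on)
    then show ?thesis by (simp add: constant_on_def)
  qed
  then obtain c where c: "\<And>i w. w \<in> D \<Longrightarrow> X w $ i - F w $ i = c i"
    by metis
  have "\<forall>w\<in>D. X w = F w + (\<chi> i. c i)"
    by (auto simp: vec_eq_iff c[symmetric])
  then show "X \<in> {X. \<exists>C. \<forall>w\<in>D. X w = F w + C}" by blast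
next
  fix X assume "X \<in> {X. \<exists>C. \<forall>w\<in>D. X w = F w + C}"
  then obtain C where C: "\<And>w. w \<in> D \<Longrightarrow> X w = F w + C" by blast
  have "((\<lambda>z. X z $ i) has_field_derivative \<Phi> w $ i) (at w)" if "w \<in> D" for w i
  proof (rule has_field_derivative_transform_within_open[OF _ \<open>open D\<close> that])
    show "((\<lambda>z. F z $ i + C $ i) has_field_derivative \<Phi> w $ i) (at w)"
      using F that by (intro DERIV_add[OF _ DERIV_const, simplified])
        (simp add: indefinite_integral_def)
  qed (simp add: C)
  then show "X \<in> indefinite_integral D \<Phi>"
    by (simp add: indefinite_integral_def)
qed

lemma has_field_derivative_powi_divide:
  fixes w :: complex
  assumes "w \<noteq> 0" and "k \<noteq> 0"
  shows "((\<lambda>z. z powi k / of_int k) has_field_derivative w powi (k - 1)) (at w)"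
  using assms by (auto intro!: derivative_eq_intros)

text \<open>
  Every exponent on the right is kept as \<open>k - 1\<close>, with \<open>k\<close> the exponent of the
  corresponding term of \<open>henneberg_curve\<close>, so that the power rule applies term by term.
\<close>

lemma henneberg_integrand_expand:
  assumes w: "w \<noteq> 0"
  shows "weierstrass_integrand (henneberg_f m n) (henneberg_g m) (henneberg_h n lam) w = vector
    [w powi (m + n - 1 - 1) - w powi (3 * m + n - 1 - 1) - lam\<^sup>2 * w powi (m + 3 * n - 1 - 1)
       - w powi (- (m + n + 1) - 1) + w powi (m - n - 1 - 1) + lam\<^sup>2 * w powi (n - m - 1 - 1),
     \<i> * (w powi (m + n - 1 - 1) + w powi (3 * m + n - 1 - 1) + lam\<^sup>2 * w powi (m + 3 * n - 1 - 1)
       - w powi (- (m + n + 1) - 1) - w powi (m - n - 1 - 1) - lam\<^sup>2 * w powi (n - m - 1 - 1)),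
     2 * (w powi (2 * m + n - 1 - 1) - w powi (- (n + 1) - 1)),
     2 * lam * (w powi (m + 2 * n - 1 - 1) - w powi (- (m + 1) - 1))]"
proof -
  \<comment> \<open>The powers get an opaque name because the law of exponents is all that matters here.\<close>
  define P where "P k = w powi k" for k
  have add: "P k * P l = P (k + l)" for k l
    using w by (simp add: P_def power_int_add)
  have add': "P k * (P l * x) = P (k + l) * x" for k l x
    by (simp add: add flip: mult.assoc)
  have add2: "P k * (2 * P l) = 2 * P (k + l)" for k l
    by (simp flip: add)
  have sq: "(P k)\<^sup>2 = P (2 * k)" for k
    by (simp add: power2_eq_square add)
  have f: "henneberg_f m n w = 2 * (P (m + n - 2) - P (- m - n - 2))"
    by (simp add: henneberg_f_def add algebra_simps flip: P_def)
  show ?thesis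
    unfolding weierstrass_integrand_def henneberg_g_def henneberg_h_def f P_def[symmetric]
    by (simp add: vec_eq_iff forall_4 power_mult_distrib sq; intro conjI;
        simp add: ring_distribs mult_ac add add' add2; simp add: algebra_simps minus_diff_commute)
qed

lemma henneberg_curve_primitive:
  assumes "odd m" and "odd n" and "m > 0" and "n > 0"
  shows "henneberg_curve m n lam C \<in> indefinite_integral (- {0})
           (weierstrass_integrand (henneberg_f m n) (henneberg_g m) (henneberg_h n lam))"
proof -
  \<comment> \<open>The terms with exponent \<open>- k\<close> carry the denominator \<open>k\<close>, hence the sign.\<close>
  have neg: "((\<lambda>z. z powi (- k) / of_int k) has_field_derivative - (w powi (- k - 1))) (at w)"
    if "w \<noteq> 0" "k \<noteq> 0" for w :: complex and k
    using DERIV_minus[OF has_field_derivative_powi_divide[of w "- k"]] that by simp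
  \<comment> \<open>Either number can have any sign, but both are odd.\<close>
  have "m - n - 1 \<noteq> 0" "n - m - 1 \<noteq> 0"
    using \<open>odd m\<close> \<open>odd n\<close> by presburger+
  then have nz: "m + n - 1 \<noteq> 0" "3 * m + n - 1 \<noteq> 0" "m + 3 * n - 1 \<noteq> 0" "m + n + 1 \<noteq> 0"
    "m - n - 1 \<noteq> 0" "n - m - 1 \<noteq> 0" "2 * m + n - 1 \<noteq> 0" "n + 1 \<noteq> 0" "m + 2 * n - 1 \<noteq> 0" "m + 1 \<noteq> 0"
    using \<open>m > 0\<close> \<open>n > 0\<close> by linarith+
  have "((\<lambda>z. henneberg_curve m n lam C z $ i) has_field_derivative
      weierstrass_integrand (henneberg_f m n) (henneberg_g m) (henneberg_h n lam) w $ i) (at w)"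
    if w: "w \<noteq> 0" for w i
  proof -
    note d = has_field_derivative_powi_divide[OF w] neg[OF w]
    show ?thesis
      unfolding henneberg_curve_def henneberg_integrand_expand[OF w]
      by (insert exhaust_4[of i]; elim disjE; hypsubst; unfold vector_4_nth;
          rule DERIV_cong, (rule d nz DERIV_add DERIV_diff DERIV_cmult DERIV_const)+, simp)
  qed
  then show ?thesis by (simp add: indefinite_integral_def)
qed

lemma henneberg_curve_eq_translate:
  "henneberg_curve m n lam C w = henneberg_curve m n lam 0 w + C"
  by (simp add: henneberg_curve_def vec_eq_iff forall_4)

theorem mainTheorem1:
  fixes m n :: int and lam :: complex
  assumes "odd m" and "odd n" and "m > 0" and "n > 0"
  shows "indefinite_integral (- {0})
           (weierstrass_integrand (henneberg_f m n) (henneberg_g m) (henneberg_h n lam))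
         = {X. \<exists>C. \<forall>w\<in>- {0}. X w = henneberg_curve m n lam C w}
       \<and> henneberg_surface m n lam
         = {Y. \<exists>C. \<forall>w\<in>- {0}. Y w = Re_vec (henneberg_curve m n lam C w)}"
proof
  have "connected (- {0 :: complex})"
    by (rule connected_punctured_universe) simp
  then show int: "indefinite_integral (- {0})
           (weierstrass_integrand (henneberg_f m n) (henneberg_g m) (henneberg_h n lam))
         = {X. \<exists>C. \<forall>w\<in>- {0}. X w = henneberg_curve m n lam C w}"
    using indefinite_integral_eq_translates[OF _ _ henneberg_curve_primitive[OF assms, of lam 0]]
    by (simp add: open_Compl flip: henneberg_curve_eq_translate)
  show "henneberg_surface m n lam
         = {Y. \<exists>C. \<forall>w\<in>- {0}. Y w = Re_vec (henneberg_curve m n lam C w)}"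
    unfolding henneberg_surface_def associated_surface_def int
    by (intro Collect_cong) auto
qed

end
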